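(* Let $m=x_{i_1}\cdots x_{i_s}$ be a square-free monomial in $S=\mathbb{K}[x_1,\ldots,x_n]$ (with $s\ge 1$ and $i_1<\cdots<i_s\le n$), with $T(m) = (t_0,t_1,\ldots,t_k)$ and $IT(m) = (i_{t_0},i_{t_1},\ldots,i_{t_k})$, and let $I = {\rm sfBorel}(m)$. If $t_0 \leq i_{t_k}$, then $$\widehat{\alpha}(I) = 1 + \frac{s-1}{i_{t_k}-t_k+1}.$$
   Context: $\mathbb{K}$ is a field of characteristic zero and $S=\mathbb{K}[x_1,\ldots,x_n]$. Borel moves: for a monomial $m$, if $x_i \mid m$ and $j<i$, then $x_j\cdot\frac{m}{x_i}$ is called a Borel move of $m$. For a square-free monomial $m\in S$, ${\rm sfBorel}(m)\subseteq S$ is the square-free monomial ideal generated by all square-free monomials that can be obtained from $m$ by a (possibly empty) sequence of Borel moves. The tuples $T(m)$, $IT(m)$: for $m=x_{i_1}\cdots x_{i_s}$ with $i_1<\cdots<i_s$, put $t_0=s$ and, recursively, $t_p=\max\{j<t_{p-1} \mid i_j<i_{j+1}-1\}$ as long as this set is non-empty; $T(m)=(t_0,t_1,\ldots,t_k)$ is the resulting tuple, where $t_k$ is the last term defined. Then $IT(m)=(i_{t_0},i_{t_1},\ldots,i_{t_k})$. Waldschmidt constant: for a square-free monomial ideal $I$ with minimal primary decomposition $I=P_1\cap\cdots\cap P_r$, the $q$-th symbolic power is $I^{(q)}=P_1^q\cap\cdots\cap P_r^q$. For a homogeneous ideal $J$, $\alpha(J)$ denotes the smallest degree of a generator of $J$.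 The Waldschmidt constant of $I$ is $\widehat{\alpha}(I)=\lim_{q\to\infty}\alpha(I^{(q)})/q$. *)

theory Defs
  imports Complex_Main "HOL-Library.Poly_Mapping" "HOL-Algebra.Ideal_Product"
begin

text \<open>
  A monomial is its exponent vector, of type \<open>nat \<Rightarrow>\<^sub>0 nat\<close>, so the product of monomials is
  the sum of exponent vectors. The variables are \<open>x\<^sub>1, x\<^sub>2, \<dots>\<close>; there is no variable with index 0.
\<close>

type_synonym monom = "nat \<Rightarrow>\<^sub>0 nat"
type_synonym 'k mpoly = "monom \<Rightarrow>\<^sub>0 'k"

text \<open>The ring \<open>K[x\<^sub>1, \<dots>, x\<^sub>n]\<close>, as a subring of the ring of all finitely supported maps.\<close>

definition poly_ring :: "nat \<Rightarrow> ('k::field_char_0) mpoly ring" where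
  "poly_ring n = \<lparr> carrier = {p. \<forall>m\<in>Poly_Mapping.keys p. Poly_Mapping.keys m \<subseteq> {1..n}},
                   mult = (*), one = 1, zero = 0, add = (+) \<rparr>"

lemma cring_poly_ring: "cring (poly_ring n :: ('k::field_char_0) mpoly ring)"
proof (intro cringI abelian_groupI comm_monoidI)
  fix p q :: "'k mpoly"
  assume pq: "p \<in> carrier (poly_ring n)" "q \<in> carrier (poly_ring n)"
  then show "p \<oplus>\<^bsub>poly_ring n\<^esub> q \<in> carrier (poly_ring n)"
    using keys_add[of p q] by (fastforce simp: poly_ring_def)
  have "Poly_Mapping.keys m \<subseteq> {1..n}" if m: "m \<in> Poly_Mapping.keys (p * q)" for m
  proof -
    obtain a b where "m = a + b" "a \<in> Poly_Mapping.keys p" "b \<in> Poly_Mapping.keys q"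
      using m keys_mult[of p q] by blast
    then show ?thesis using pq keys_add[of a b] by (fastforce simp: poly_ring_def)
  qed
  then show "p \<otimes>\<^bsub>poly_ring n\<^esub> q \<in> carrier (poly_ring n)" by (simp add: poly_ring_def)
next
  fix p :: "'k mpoly" assume "p \<in> carrier (poly_ring n)"
  then show "\<exists>q\<in>carrier (poly_ring n). q \<oplus>\<^bsub>poly_ring n\<^esub> p = \<zero>\<^bsub>poly_ring n\<^esub>"
    by (intro bexI[of _ "- p"]) (auto simp: poly_ring_def)
qed (auto simp: poly_ring_def algebra_simps)


section \<open>Square-free Borel ideals\<close>

definition sqfree_monom :: "monom \<Rightarrow> bool" where
  "sqfree_monom m \<longleftrightarrow> (\<forall>i. Poly_Mapping.lookup m i \<le> 1)"

definition borel_move :: "monom \<Rightarrow> monom \<Rightarrow> bool" where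
  "borel_move m m' \<longleftrightarrow> (\<exists>i j. i \<in> Poly_Mapping.keys m \<and> 1 \<le> j \<and> j < i \<and>
     m' = Poly_Mapping.single j 1 + (m - Poly_Mapping.single i 1))"

text \<open>Only the resulting monomial has to be square-free, not the intermediate ones.\<close>

definition sfBorel :: "nat \<Rightarrow> monom \<Rightarrow> ('k::field_char_0) mpoly set" where
  "sfBorel n m = Idl\<^bsub>poly_ring n\<^esub>
     {Poly_Mapping.single u 1 | u. borel_move\<^sup>*\<^sup>* m u \<and> sqfree_monom u}"


section \<open>The tuples \<open>T(m)\<close> and \<open>IT(m)\<close>\<close>

text \<open>
  For \<open>m = x\<^bsub>i\<^sub>1\<^esub> \<cdots> x\<^bsub>i\<^sub>s\<^esub>\<close> with \<open>i\<^sub>1 < \<cdots> < i\<^sub>s\<close>, \<open>var_index m j\<close> is \<open>i\<^sub>j\<close>, counted from \<open>j = 1\<close>.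
\<close>

definition var_index :: "monom \<Rightarrow> nat \<Rightarrow> nat" where
  "var_index m j = sorted_list_of_set (Poly_Mapping.keys m) ! (j - 1)"

text \<open>
  \<open>i\<^sub>j < i\<^sub>j\<^sub>+\<^sub>1 - 1\<close> is written without subtraction; \<open>j\<close> ranges over positive indices only.
\<close>

definition gaps_below :: "(nat \<Rightarrow> nat) \<Rightarrow> nat \<Rightarrow> nat set" where
  "gaps_below i t = {j. 1 \<le> j \<and> j < t \<and> i j + 1 < i (j + 1)}"

lemma Max_gaps_below: "gaps_below i t \<noteq> {} \<Longrightarrow> Max (gaps_below i t) < t"
  using Max_in[of "gaps_below i t"] by (auto simp: gaps_below_def)

function T_from :: "(nat \<Rightarrow> nat) \<Rightarrow> nat \<Rightarrow> nat list" where
  "T_from i t = t # (if gaps_below i t = {} then [] else T_from i (Max (gaps_below i t)))"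
  by auto
termination
  by (relation "measure snd") (auto intro: Max_gaps_below)

declare T_from.simps [simp del]

definition T_tuple :: "monom \<Rightarrow> nat list" where
  "T_tuple m = T_from (var_index m) (card (Poly_Mapping.keys m))"

definition IT_tuple :: "monom \<Rightarrow> nat list" where
  "IT_tuple m = map (var_index m) (T_tuple m)"


section \<open>Symbolic powers\<close>

definition radical :: "('a, 'b) ring_scheme \<Rightarrow> 'a set \<Rightarrow> 'a set" where
  "radical R I = {a \<in> carrier R. \<exists>k::nat. a [^]\<^bsub>R\<^esub> k \<in> I}"

definition primary_ideal :: "('a, 'b) ring_scheme \<Rightarrow> 'a set \<Rightarrow> bool" where
  "primary_ideal R Q \<longleftrightarrow> ideal Q R \<and> Q \<noteq> carrier R \<and>
     (\<forall>a\<in>carrier R. \<forall>b\<in>carrier R. a \<otimes>\<^bsub>R\<^esub> b \<in> Q \<longrightarrow> a \<in> Q \<or> b \<in> radical R Q)"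

definition minimal_primary_decomposition ::
    "('a, 'b) ring_scheme \<Rightarrow> 'a set \<Rightarrow> 'a set set \<Rightarrow> bool" where
  "minimal_primary_decomposition R I Ps \<longleftrightarrow>
     finite Ps \<and> (\<forall>P\<in>Ps. primary_ideal R P) \<and> carrier R \<inter> \<Inter>Ps = I \<and>
     inj_on (radical R) Ps \<and> (\<forall>P\<in>Ps. carrier R \<inter> \<Inter>(Ps - {P}) \<noteq> I)"

fun ideal_power :: "('a, 'b) ring_scheme \<Rightarrow> 'a set \<Rightarrow> nat \<Rightarrow> 'a set" where
  "ideal_power R I 0 = carrier R"
| "ideal_power R I (Suc q) = ideal_prod R (ideal_power R I q) I"

text \<open>
  The definite description is meaningful for radical ideals, hence for square-free monomial
  ideals: their minimal primary decomposition is unique and consists of their minimal primes.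
\<close>

definition symbolic_power :: "('a, 'b) ring_scheme \<Rightarrow> 'a set \<Rightarrow> nat \<Rightarrow> 'a set" where
  "symbolic_power R I q =
     carrier R \<inter> (\<Inter>P\<in>(THE Ps. minimal_primary_decomposition R I Ps). ideal_power R P q)"


section \<open>The Waldschmidt constant\<close>

definition monom_degree :: "monom \<Rightarrow> nat" where
  "monom_degree m = (\<Sum>i\<in>Poly_Mapping.keys m. Poly_Mapping.lookup m i)"

definition form_of_degree :: "nat \<Rightarrow> ('k::field_char_0) mpoly \<Rightarrow> bool" where
  "form_of_degree d p \<longleftrightarrow> p \<noteq> 0 \<and> (\<forall>m\<in>Poly_Mapping.keys p. monom_degree m = d)"

text \<open>
  The smallest degree of an element of a generating set of \<open>J\<close> by non-zero forms. The value does
  not depend on whether arbitrary or only minimal such generating sets are considered.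
\<close>

definition initial_degree :: "nat \<Rightarrow> ('k::field_char_0) mpoly set \<Rightarrow> nat" where
  "initial_degree n J = (LEAST d. \<exists>G \<subseteq> carrier (poly_ring n).
     (\<forall>g\<in>G. \<exists>e. form_of_degree e g) \<and> Idl\<^bsub>poly_ring n\<^esub> G = J \<and> (\<exists>g\<in>G. form_of_degree d g))"

definition waldschmidt_seq :: "nat \<Rightarrow> ('k::field_char_0) mpoly set \<Rightarrow> nat \<Rightarrow> real" where
  "waldschmidt_seq n I q = real (initial_degree n (symbolic_power (poly_ring n) I q)) / real q"

definition waldschmidt_constant :: "nat \<Rightarrow> ('k::field_char_0) mpoly set \<Rightarrow> real" where
  "waldschmidt_constant n I = lim (waldschmidt_seq n I)"

end

theory Submission
  imports Defs
begin

text \<open>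
  Only \<open>i\<^sub>1\<close> matters in the end. There is no gap below \<open>t = t\<^sub>k\<close>, so \<open>i\<^sub>1, \<dots>, i\<^sub>t\<close> are consecutive,
  \<open>i\<^sub>t - t + 1 = i\<^sub>1\<close>, and the claimed value is \<open>(i\<^sub>1 + s - 1) / i\<^sub>1\<close>.

  A monomial \<open>w\<close> lies in \<open>I\<close> iff, for each \<open>l \<le> s\<close>, at least \<open>l\<close> of the variables
  \<open>x\<^sub>1, \<dots>, x\<^bsub>i\<^sub>l\<^esub>\<close> divide it. By pigeonhole this says that the support of \<open>w\<close> meets every set \<open>A\<close> of
  \<open>i\<^sub>l - l + 1\<close> indices in \<open>{1..i\<^sub>l}\<close> (\<open>sfBorel_eq_cover_ideal\<close>). So \<open>I\<close> is an intersection of prime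
  ideals generated by variables, the inclusion-minimal ones form its unique minimal primary
  decomposition, and \<open>w\<close> lies in the \<open>q\<close>-th symbolic power iff the exponents of \<open>w\<close> over each
  such \<open>A\<close> add up to at least \<open>q\<close> (\<open>symbolic_power_cover_ideal\<close>). What remains is to
  minimise the degree of \<open>w\<close> under these linear constraints.

  For the upper bound (\<open>degree_upper_bound\<close>), give the first \<open>i\<^sub>1 + s - 1\<close> variables the same exponent,
  about \<open>q / i\<^sub>1\<close>: since \<open>i\<^sub>l \<ge> i\<^sub>1 + l - 1\<close>, every \<open>A\<close> contains at least \<open>i\<^sub>1\<close> of these variables.

  For the lower bound (\<open>degree_lower_bound\<close>), the constraints for \<open>l = t\<close> say that any \<open>i\<^sub>1\<close> of the first
  \<open>i\<^sub>t\<close> variables carry weight at least \<open>q\<close>. As \<open>s \<le> i\<^sub>t\<close>, one can choose the \<open>s - 1\<close> heaviest of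
  them, and by averaging these carry weight at least \<open>q (s - 1) / i\<^sub>1\<close>. The remaining variables among
  \<open>x\<^sub>1, \<dots>, x\<^bsub>i\<^sub>s\<^esub>\<close> form one of the sets \<open>A\<close> for \<open>l = s\<close> and contribute another \<open>q\<close>.

  The two bounds differ by a term that does not depend on \<open>q\<close>, so the limit follows.
\<close>

section \<open>Irredundant intersections of primes as primary decompositions\<close>

text \<open>
  Elements outside \<open>P\<close> chosen from the members of \<open>F\<close> multiply to an element of the intersection
  outside \<open>P\<close>. Here \<open>P\<close> is only assumed multiplicatively prime, so that it may be the
  radical of a primary ideal without showing first that this radical is closed under addition.
\<close>

lemma (in cring) finite_Inter_subset_prime:
  assumes "finite F" and "\<forall>J\<in>F. ideal J R"
    and prime: "\<And>a b. \<lbrakk>a \<in> carrier R; b \<in> carrier R; a \<otimes> b \<in> P\<rbrakk> \<Longrightarrow> a \<in> P \<or> b \<in> P"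
    and "\<one> \<notin> P" and "carrier R \<inter> \<Inter>F \<subseteq> P"
  shows "\<exists>J\<in>F. J \<subseteq> P"
proof (rule ccontr)
  assume none: "\<not> (\<exists>J\<in>F. J \<subseteq> P)"
  have "\<exists>a\<in>carrier R \<inter> \<Inter>G. a \<notin> P" if "finite G" "G \<subseteq> F" for G
    using that
  proof (induction G rule: finite_induct)
    case empty
    then show ?case using assms(4) by auto
  next
    case (insert J G)
    then obtain a where a: "a \<in> carrier R" "a \<in> \<Inter>G" "a \<notin> P" by auto
    have J: "ideal J R" using insert.prems assms(2) by auto
    obtain b where b: "b \<in> J" "b \<notin> P" using none insert.prems by auto
    have bc: "b \<in> carrier R" using J b by (meson ideal.Icarr)
    have "a \<otimes> b \<in> J" using J a b by (meson ideal.I_l_closed)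
    moreover have "a \<otimes> b \<in> K" if "K \<in> G" for K
      using that insert.prems assms(2) a bc by (meson InterD ideal.I_r_closed insert_subset subsetD)
    moreover have "a \<otimes> b \<notin> P" using prime a b bc by blast
    ultimately show ?case using a bc by (intro bexI[of _ "a \<otimes> b"]) auto
  qed
  then show False using assms(1,5) by blast
qed

lemma (in cring) radical_primary_prime:
  assumes "primary_ideal R Q" and "a \<in> carrier R" "b \<in> carrier R" "a \<otimes> b \<in> radical R Q"
  shows "a \<in> radical R Q \<or> b \<in> radical R Q"
proof -
  obtain k :: nat where "(a \<otimes> b) [^] k \<in> Q" using assms(4) by (auto simp: radical_def)
  then have "a [^] k \<otimes> b [^] k \<in> Q" using assms by (simp add: nat_pow_distrib)
  then consider "a [^] k \<in> Q" | "b [^] k \<in> radical R Q"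
    using assms(1-3) unfolding primary_ideal_def by (meson nat_pow_closed)
  then show ?thesis
  proof cases
    case 2
    then obtain l :: nat where "b [^] (k * l) \<in> Q"
      using assms by (auto simp: radical_def nat_pow_pow)
    then show ?thesis using assms by (auto simp: radical_def)
  qed (use assms in \<open>auto simp: radical_def\<close>)
qed

lemma (in cring) subset_radical: "ideal Q R \<Longrightarrow> Q \<subseteq> radical R Q"
  unfolding radical_def by (auto intro!: exI[of _ "Suc 0"] simp: ideal.Icarr)

lemma (in cring) one_notin_radical: "primary_ideal R Q \<Longrightarrow> \<one> \<notin> radical R Q"
  using ideal.one_imp_carrier[of Q R] by (auto simp: radical_def primary_ideal_def)

lemma (in cring) radical_prime:
  assumes "primeideal P R"
  shows "radical R P = P"
proof -
  interpret P: primeideal P R by fact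
  have "a \<in> P" if "a \<in> carrier R" "a [^] k \<in> P" for a and k :: nat
    using that(2)
  proof (induction k)
    case 0
    then show ?case using P.one_imp_carrier P.I_notcarr by simp
  next
    case (Suc k)
    then show ?case using P.I_prime[of "a [^] k" a] that(1) by auto
  qed
  then show ?thesis using subset_radical[OF P.is_ideal] by (auto simp: radical_def)
qed

lemma (in cring) minimal_primary_decomposition_primes:
  assumes "finite \<P>" and primes: "\<forall>P\<in>\<P>. primeideal P R"
    and antichain: "\<forall>P\<in>\<P>. \<forall>P'\<in>\<P>. P \<subseteq> P' \<longrightarrow> P = P'"
  shows "minimal_primary_decomposition R (carrier R \<inter> \<Inter>\<P>) \<P>"
  unfolding minimal_primary_decomposition_def
proof (intro conjI ballI)
  fix P assume P: "P \<in> \<P>"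
  then interpret P: primeideal P R using primes by blast
  show "primary_ideal R P"
    using P.I_notcarr P.I_prime P.is_ideal subset_radical[OF P.is_ideal]
    unfolding primary_ideal_def by blast
  show "carrier R \<inter> \<Inter>(\<P> - {P}) \<noteq> carrier R \<inter> \<Inter>\<P>"
  proof
    assume "carrier R \<inter> \<Inter>(\<P> - {P}) = carrier R \<inter> \<Inter>\<P>"
    then have "\<exists>J\<in>\<P> - {P}. J \<subseteq> P"
      using P assms(1) primes P.one_imp_carrier P.I_notcarr
      by (intro finite_Inter_subset_prime P.I_prime) (auto simp: primeideal_def)
    then show False using antichain P by blast
  qed
qed (use assms radical_prime in \<open>auto simp: inj_on_def\<close>)

text \<open>
  Each \<open>P \<in> \<P>\<close> contains some \<open>Q \<in> \<Q>\<close>, and the radical of \<open>Q\<close> contains some \<open>P' \<in> \<P>\<close>; as \<open>\<P>\<close> is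
  an antichain, \<open>P\<close> is that radical. An element \<open>b\<close> outside \<open>P\<close> but in all other members of \<open>\<P>\<close>
  multiplies \<open>P\<close> into the intersection, hence into \<open>Q\<close>, and is not in the radical of \<open>Q\<close>; so primary
  forces \<open>P = Q\<close>. Thus \<open>\<P> \<subseteq> \<Q>\<close>, and irredundancy of \<open>\<Q>\<close> rules out further members.
\<close>

lemma (in cring) minimal_primary_decomposition_unique:
  assumes "finite \<P>" and primes: "\<forall>P\<in>\<P>. primeideal P R"
    and antichain: "\<forall>P\<in>\<P>. \<forall>P'\<in>\<P>. P \<subseteq> P' \<longrightarrow> P = P'"
    and dec: "minimal_primary_decomposition R (carrier R \<inter> \<Inter>\<P>) \<Q>"
  shows "\<Q> = \<P>"
proof -
  have fin: "finite \<Q>" and prim: "\<And>Q. Q \<in> \<Q> \<Longrightarrow> primary_ideal R Q"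
    and int: "carrier R \<inter> \<Inter>\<Q> = carrier R \<inter> \<Inter>\<P>"
    and irred: "\<And>Q. Q \<in> \<Q> \<Longrightarrow> carrier R \<inter> \<Inter>(\<Q> - {Q}) \<noteq> carrier R \<inter> \<Inter>\<P>"
    using dec unfolding minimal_primary_decomposition_def by blast+
  have primQ: "ideal Q R" if "Q \<in> \<Q>" for Q using prim[OF that] by (simp add: primary_ideal_def)
  have primP: "ideal P R" if "P \<in> \<P>" for P using primes that by (simp add: primeideal_def)
  have rad: "\<exists>Q\<in>\<Q>. radical R Q = P" if P: "P \<in> \<P>" for P
  proof -
    interpret P: primeideal P R using P primes by blast
    have "carrier R \<inter> \<Inter>\<Q> \<subseteq> P" using int P by auto
    then obtain Q where Q: "Q \<in> \<Q>" "Q \<subseteq> P"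
      using finite_Inter_subset_prime[OF fin, of P] primQ P.I_prime P.one_imp_carrier P.I_notcarr by blast
    have "radical R Q \<subseteq> radical R P" using Q by (auto simp: radical_def)
    then have QP: "radical R Q \<subseteq> P" using radical_prime P.primeideal by blast
    have "carrier R \<inter> \<Inter>\<P> \<subseteq> radical R Q"
      using int Q subset_radical[OF primQ] by blast
    then obtain P' where "P' \<in> \<P>" "P' \<subseteq> radical R Q"
      using finite_Inter_subset_prime[OF assms(1), of "radical R Q"] primP
        radical_primary_prime[OF prim[OF Q(1)]] one_notin_radical[OF prim[OF Q(1)]] by blast
    then show ?thesis using antichain P Q QP by (metis order_antisym order_trans)
  qed
  have mem: "P \<in> \<Q>" if P: "P \<in> \<P>" for P
  proof -
    interpret P: primeideal P R using P primes by blast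
    obtain Q where Q: "Q \<in> \<Q>" "radical R Q = P" using rad P by blast
    have "\<not> carrier R \<inter> \<Inter>(\<P> - {P}) \<subseteq> P"
      using finite_Inter_subset_prime[of "\<P> - {P}" P] assms(1) primP P.I_prime
        P.one_imp_carrier P.I_notcarr antichain P by blast
    then obtain b where b: "b \<in> carrier R" "b \<in> \<Inter>(\<P> - {P})" "b \<notin> P" by blast
    have "a \<in> Q" if a: "a \<in> P" for a
    proof -
      have ac: "a \<in> carrier R" using a by simp
      have "a \<otimes> b \<in> P'" if "P' \<in> \<P>" for P'
        using that a b ac primP[OF that]
        by (cases "P' = P") (auto intro: ideal.I_r_closed ideal.I_l_closed)
      then have "a \<otimes> b \<in> Q" using int Q(1) ac b(1) by blast
      then show ?thesis using prim[OF Q(1)] Q(2) b ac unfolding primary_ideal_def by blast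
    qed
    then have "Q = P" using Q subset_radical[OF primQ[OF Q(1)]] by blast
    then show ?thesis using Q by simp
  qed
  have "Q \<in> \<P>" if Q: "Q \<in> \<Q>" for Q
  proof (rule ccontr)
    assume "Q \<notin> \<P>"
    then have "\<P> \<subseteq> \<Q> - {Q}" using mem by blast
    then have "carrier R \<inter> \<Inter>(\<Q> - {Q}) = carrier R \<inter> \<Inter>\<P>" using int by blast
    then show False using irred[OF Q] by blast
  qed
  with mem show ?thesis by blast
qed

section \<open>Monomial ideals\<close>

abbreviation (input) indet :: "nat \<Rightarrow> monom" where
  "indet v \<equiv> Poly_Mapping.single v 1"

abbreviation (input) monom_poly :: "monom \<Rightarrow> ('k::field_char_0) mpoly" where
  "monom_poly m \<equiv> Poly_Mapping.single m 1"

definition monoms :: "nat \<Rightarrow> monom set" where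
  "monoms n = {m. Poly_Mapping.keys m \<subseteq> {1..n}}"

text \<open>
  Sets of exponent vectors that form an ideal of the monoid of all exponent vectors: those whose
  monomials span an ideal.
\<close>

definition multiple_closed :: "monom set \<Rightarrow> bool" where
  "multiple_closed M \<longleftrightarrow> (\<forall>m\<in>M. \<forall>w. m + w \<in> M)"

text \<open>
  For a set closed under multiples this is the ideal spanned by the monomials in \<open>M\<close> that
  involve only \<open>x\<^sub>1, \<dots>, x\<^sub>n\<close>. Membership is tested on the occurring monomials, which turns each
  ideal equality below into a statement about exponent vectors.
\<close>

definition monomial_ideal :: "nat \<Rightarrow> monom set \<Rightarrow> ('k::field_char_0) mpoly set" where
  "monomial_ideal n M = {p \<in> carrier (poly_ring n). Poly_Mapping.keys p \<subseteq> M}"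

lemma poly_ring_simps [simp]:
  "x \<otimes>\<^bsub>poly_ring n\<^esub> y = x * y" "x \<oplus>\<^bsub>poly_ring n\<^esub> y = x + y"
  "\<one>\<^bsub>poly_ring n\<^esub> = 1" "\<zero>\<^bsub>poly_ring n\<^esub> = 0"
  by (simp_all add: poly_ring_def)

lemma carrier_poly_ring: "p \<in> carrier (poly_ring n) \<longleftrightarrow> Poly_Mapping.keys p \<subseteq> monoms n"
  by (auto simp: poly_ring_def monoms_def)

lemma monoms_add: "a + b \<in> monoms n \<longleftrightarrow> a \<in> monoms n \<and> b \<in> monoms n"
proof -
  have "Poly_Mapping.keys (a + b) = Poly_Mapping.keys a \<union> Poly_Mapping.keys b"
    by (auto simp: in_keys_iff lookup_add)
  then show ?thesis by (simp add: monoms_def)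
qed

lemma ring_poly_ring: "ring (poly_ring n :: ('k::field_char_0) mpoly ring)"
  by (rule cring.axioms(1)[OF cring_poly_ring])

lemma monomial_ideal_is_ideal:
  assumes "multiple_closed M"
  shows "ideal (monomial_ideal n M) (poly_ring n :: ('k::field_char_0) mpoly ring)"
proof (rule idealI[OF ring_poly_ring])
  interpret cring "poly_ring n :: 'k mpoly ring" by (rule cring_poly_ring)
  show "subgroup (monomial_ideal n M) (add_monoid (poly_ring n :: 'k mpoly ring))"
  proof (rule add.subgroupI)
    fix a :: "'k mpoly" assume a: "a \<in> monomial_ideal n M"
    then have "- a \<in> monomial_ideal n M" "a \<in> carrier (poly_ring n)" "- a \<in> carrier (poly_ring n)"
      by (auto simp: monomial_ideal_def carrier_poly_ring)
    then show "\<ominus>\<^bsub>poly_ring n\<^esub> a \<in> monomial_ideal n M"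
      using minus_equality[of "- a" a] by simp
  next
    fix a b :: "'k mpoly" assume "a \<in> monomial_ideal n M" "b \<in> monomial_ideal n M"
    then show "a \<oplus>\<^bsub>poly_ring n\<^esub> b \<in> monomial_ideal n M"
      using keys_add[of a b] by (auto simp: monomial_ideal_def carrier_poly_ring)
  qed (auto simp: monomial_ideal_def carrier_poly_ring intro: exI[of _ 0])
  have mult: "a * x \<in> monomial_ideal n M"
    if "a \<in> monomial_ideal n M" "x \<in> carrier (poly_ring n)" for a x :: "'k mpoly"
  proof -
    have "k \<in> M" if "k \<in> Poly_Mapping.keys (a * x)" for k
      using that keys_mult[of a x] \<open>a \<in> monomial_ideal n M\<close> assms
      by (auto simp: monomial_ideal_def multiple_closed_def)
    moreover have "a * x \<in> carrier (poly_ring n)"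
      using that m_closed[of a x] by (simp add: monomial_ideal_def)
    ultimately show ?thesis by (auto simp: monomial_ideal_def)
  qed
  fix a x :: "'k mpoly" assume "a \<in> monomial_ideal n M" "x \<in> carrier (poly_ring n)"
  then show "x \<otimes>\<^bsub>poly_ring n\<^esub> a \<in> monomial_ideal n M" "a \<otimes>\<^bsub>poly_ring n\<^esub> x \<in> monomial_ideal n M"
    using mult[of a x] by (simp_all add: mult.commute)
qed

lemma lookup_sum_terms:
  fixes p :: "('k::field_char_0) mpoly"
  assumes "finite F"
  shows "Poly_Mapping.lookup (\<Sum>m\<in>F. Poly_Mapping.single m (Poly_Mapping.lookup p m)) x
           = (if x \<in> F then Poly_Mapping.lookup p x else 0)"
  using assms by (simp add: lookup_sum lookup_single when_def)

lemma sum_terms: "(\<Sum>m\<in>Poly_Mapping.keys p. Poly_Mapping.single m (Poly_Mapping.lookup p m)) = p"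
  for p :: "('k::field_char_0) mpoly"
  by (rule poly_mapping_eqI) (simp add: lookup_sum_terms in_keys_iff)

lemma ideal_contains_if_monomials:
  fixes J :: "('k::field_char_0) mpoly set"
  assumes J: "ideal J (poly_ring n)" and p: "p \<in> carrier (poly_ring n)"
    and "\<And>m. m \<in> Poly_Mapping.keys p \<Longrightarrow> monom_poly m \<in> J"
  shows "p \<in> J"
proof -
  have scaled: "Poly_Mapping.single m c \<in> J" if "m \<in> Poly_Mapping.keys p" for m c
  proof -
    have "Poly_Mapping.single 0 c \<in> carrier (poly_ring n)"
      by (auto simp: carrier_poly_ring monoms_def)
    then show ?thesis
      using ideal.I_l_closed[OF J assms(3)[OF that], of "Poly_Mapping.single 0 c"]
      by (simp add: mult_single)
  qed
  have "(\<Sum>m\<in>F. Poly_Mapping.single m (Poly_Mapping.lookup p m)) \<in> J"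
    if "finite F" "F \<subseteq> Poly_Mapping.keys p" for F
    using that
  proof (induction F rule: finite_induct)
    case empty
    then show ?case using additive_subgroup.zero_closed[OF ideal.axioms(1)[OF J]] by simp
  next
    case (insert m F)
    then show ?case
      using additive_subgroup.a_closed[OF ideal.axioms(1)[OF J] scaled[of m "Poly_Mapping.lookup p m"]]
      by simp
  qed
  from this[of "Poly_Mapping.keys p"] show ?thesis by (simp add: sum_terms)
qed

lemma monom_poly_in_monomial_ideal:
  "monom_poly m \<in> monomial_ideal n M \<longleftrightarrow> m \<in> M \<and> m \<in> monoms n"
  by (auto simp: monomial_ideal_def carrier_poly_ring)

lemma genideal_monomials:
  assumes "B \<subseteq> monoms n"
  shows "Idl\<^bsub>poly_ring n\<^esub> {monom_poly u :: ('k::field_char_0) mpoly | u. u \<in> B}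
           = monomial_ideal n {m. \<exists>u\<in>B. \<exists>w. m = u + w}" (is "Idl\<^bsub>_\<^esub> ?G = monomial_ideal n ?M")
proof
  interpret cring "poly_ring n :: 'k mpoly ring" by (rule cring_poly_ring)
  have G: "?G \<subseteq> carrier (poly_ring n)" using assms by (auto simp: carrier_poly_ring)
  have closed: "multiple_closed ?M" 
    by (clarsimp simp: multiple_closed_def) (metis add.assoc)
  have "?G \<subseteq> monomial_ideal n ?M"
    by (clarsimp simp: monom_poly_in_monomial_ideal) (metis add.right_neutral assms subsetD)
  then show "Idl\<^bsub>poly_ring n\<^esub> ?G \<subseteq> monomial_ideal n ?M"
    by (intro genideal_minimal monomial_ideal_is_ideal closed)
  show "monomial_ideal n ?M \<subseteq> Idl\<^bsub>poly_ring n\<^esub> ?G"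
  proof
    fix p :: "'k mpoly" assume p: "p \<in> monomial_ideal n ?M"
    have I: "ideal (Idl\<^bsub>poly_ring n\<^esub> ?G) (poly_ring n)" by (rule genideal_ideal[OF G])
    show "p \<in> Idl\<^bsub>poly_ring n\<^esub> ?G"
    proof (rule ideal_contains_if_monomials[OF I])
      show "p \<in> carrier (poly_ring n)" using p by (simp add: monomial_ideal_def)
      fix m assume m: "m \<in> Poly_Mapping.keys p"
      then obtain u w where u: "u \<in> B" "m = u + w" using p by (auto simp: monomial_ideal_def)
      have "m \<in> monoms n" using p m by (auto simp: monomial_ideal_def carrier_poly_ring)
      then have "w \<in> monoms n" using u by (simp add: monoms_add)
      then have "(monom_poly w :: 'k mpoly) \<in> carrier (poly_ring n)" by (simp add: carrier_poly_ring)
      moreover have "(monom_poly u :: 'k mpoly) \<in> Idl\<^bsub>poly_ring n\<^esub> ?G"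
        using genideal_self[OF G] u(1) by blast
      ultimately have "(monom_poly u * monom_poly w :: 'k mpoly) \<in> Idl\<^bsub>poly_ring n\<^esub> ?G"
        using ideal.I_r_closed[OF I] by simp
      then show "(monom_poly m :: 'k mpoly) \<in> Idl\<^bsub>poly_ring n\<^esub> ?G" by (simp add: u mult_single)
    qed
  qed
qed

lemma monom_poly_form: "form_of_degree (monom_degree m) (monom_poly m :: ('k::field_char_0) mpoly)"
proof -
  have "Poly_Mapping.keys (monom_poly m :: 'k mpoly) = {m}" by simp
  then have "(monom_poly m :: 'k mpoly) \<noteq> 0" by (metis insert_not_empty keys_zero)
  then show ?thesis by (simp add: form_of_degree_def)
qed

text \<open>
  Any generating form is a non-zero element and so contains a monomial in \<open>M\<close> of the same degree;
  conversely all monomials of the ideal generate it.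
\<close>

lemma initial_degree_monomial_ideal:
  assumes "multiple_closed M"
  shows "initial_degree n (monomial_ideal n M :: ('k::field_char_0) mpoly set)
           = (LEAST d. \<exists>m\<in>M \<inter> monoms n. monom_degree m = d)"
proof -
  interpret cring "poly_ring n :: 'k mpoly ring" by (rule cring_poly_ring)
  let ?J = "monomial_ideal n M :: 'k mpoly set"
  have "(\<exists>G \<subseteq> carrier (poly_ring n). (\<forall>g\<in>G. \<exists>e. form_of_degree e g) \<and>
      Idl\<^bsub>poly_ring n\<^esub> G = ?J \<and> (\<exists>g\<in>G. form_of_degree d g))
    \<longleftrightarrow> (\<exists>m\<in>M \<inter> monoms n. monom_degree m = d)" (is "?L \<longleftrightarrow> ?R") for d
  proof
    assume ?L
    then obtain G and g :: "'k mpoly" where G: "G \<subseteq> carrier (poly_ring n)" "Idl\<^bsub>poly_ring n\<^esub> G = ?J"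
      and g: "g \<in> G" "form_of_degree d g" by blast
    have "g \<in> ?J" using genideal_self[OF G(1)] G g by blast
    moreover obtain m where "m \<in> Poly_Mapping.keys g"
      using g by (fastforce simp: form_of_degree_def)
    ultimately show ?R using g
      by (auto simp: form_of_degree_def monomial_ideal_def carrier_poly_ring)
  next
    assume ?R
    then obtain m where m: "m \<in> M" "m \<in> monoms n" "monom_degree m = d" by blast
    let ?B = "M \<inter> monoms n"
    let ?G = "{monom_poly u :: 'k mpoly | u. u \<in> ?B}"
    have "Idl\<^bsub>poly_ring n\<^esub> ?G = monomial_ideal n {m. \<exists>u\<in>?B. \<exists>w. m = u + w}"
      by (rule genideal_monomials) auto
    also have "\<dots> = ?J"
    proof -
      have "(\<exists>u\<in>?B. \<exists>w. k = u + w) \<longleftrightarrow> k \<in> M" if "k \<in> monoms n" for k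
        using that assms unfolding multiple_closed_def by (metis IntE IntI add.right_neutral)
      then show ?thesis unfolding monomial_ideal_def carrier_poly_ring by blast
    qed
    finally show ?L
      using m monom_poly_form by (intro exI[of _ ?G]) (auto simp: carrier_poly_ring)
  qed
  then show ?thesis unfolding initial_degree_def by presburger
qed

text \<open>
  The order of vanishing of the monomial along the ideal generated by the variables in \<open>A\<close>.
\<close>

definition weight :: "nat set \<Rightarrow> monom \<Rightarrow> nat" where
  "weight A m = (\<Sum>v\<in>A. Poly_Mapping.lookup m v)"

lemma weight_add: "weight A (a + b) = weight A a + weight A b"
  by (simp add: weight_def lookup_add sum.distrib)

lemma multiple_closed_weight: "multiple_closed {m. \<forall>A\<in>\<A>. q \<le> weight A m}"
  by (auto simp: multiple_closed_def weight_add intro: trans_le_add1)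

lemma multiple_closed_weight_single: "multiple_closed {m. q \<le> weight A m}"
  using multiple_closed_weight[of "{A}" q] by simp

lemma weight_var: "finite A \<Longrightarrow> weight A (indet v) = (if v \<in> A then 1 else 0)"
  by (simp add: weight_def lookup_single when_def)

text \<open>
  The prime ideal generated by the variables \<open>x\<^sub>v\<close> with \<open>v \<in> A\<close>.
\<close>

definition var_ideal :: "nat \<Rightarrow> nat set \<Rightarrow> ('k::field_char_0) mpoly set" where
  "var_ideal n A = monomial_ideal n {m. 1 \<le> weight A m}"

lemma var_ideal_is_ideal: "ideal (var_ideal n A) (poly_ring n :: ('k::field_char_0) mpoly ring)"
  unfolding var_ideal_def by (rule monomial_ideal_is_ideal[OF multiple_closed_weight_single])

lemma var_ideal_split:
  fixes p :: "('k::field_char_0) mpoly"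
  assumes "p \<in> carrier (poly_ring n)"
  obtains p1 p0 where "p = p1 + p0" "p1 \<in> var_ideal n A" "p0 \<in> carrier (poly_ring n)"
    "\<forall>m\<in>Poly_Mapping.keys p0. weight A m = 0"
proof -
  let ?K1 = "Poly_Mapping.keys p \<inter> {m. 1 \<le> weight A m}" and ?K0 = "Poly_Mapping.keys p \<inter> {m. weight A m = 0}"
  let ?S = "\<lambda>F. \<Sum>m\<in>F. Poly_Mapping.single m (Poly_Mapping.lookup p m)"
  have keys: "Poly_Mapping.keys (?S F) \<subseteq> F" if "finite F" for F
    using that by (auto simp: in_keys_iff lookup_sum_terms split: if_splits)
  have "p = ?S ?K1 + ?S ?K0"
    by (rule poly_mapping_eqI) (auto simp: lookup_add lookup_sum_terms in_keys_iff)
  moreover have "?S ?K1 \<in> var_ideal n A" "?S ?K0 \<in> carrier (poly_ring n)"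
    "\<forall>m\<in>Poly_Mapping.keys (?S ?K0). weight A m = 0"
    using keys[of ?K1] keys[of ?K0] assms
    unfolding var_ideal_def monomial_ideal_def carrier_poly_ring by auto
  ultimately show ?thesis by (rule that)
qed

text \<open>
  Modulo the ideal, both factors may be replaced by their parts in the variables outside \<open>A\<close>. The
  product of these parts involves only such variables, so it lies in the ideal only if it is zero,
  and polynomial rings over a field have no zero divisors.
\<close>

lemma var_ideal_prime: "primeideal (var_ideal n A) (poly_ring n :: ('k::field_char_0) mpoly ring)"
proof (rule primeidealI[OF var_ideal_is_ideal cring_poly_ring])
  have "(1 :: 'k mpoly) \<notin> var_ideal n A"
    by (simp add: var_ideal_def monomial_ideal_def weight_def)
  moreover have "(1 :: 'k mpoly) \<in> carrier (poly_ring n)"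
    by (simp add: carrier_poly_ring monoms_def)
  ultimately show "carrier (poly_ring n) \<noteq> (var_ideal n A :: 'k mpoly set)"
    by metis
  fix a b :: "'k mpoly"
  assume a: "a \<in> carrier (poly_ring n)" and b: "b \<in> carrier (poly_ring n)"
    and ab: "a \<otimes>\<^bsub>poly_ring n\<^esub> b \<in> var_ideal n A"
  obtain a1 a0 where a': "a = a1 + a0" "a1 \<in> var_ideal n A" "a0 \<in> carrier (poly_ring n)"
    "\<forall>m\<in>Poly_Mapping.keys a0. weight A m = 0" by (rule var_ideal_split[OF a, of A]) blast
  obtain b1 b0 where b': "b = b1 + b0" "b1 \<in> var_ideal n A" "b0 \<in> carrier (poly_ring n)"
    "\<forall>m\<in>Poly_Mapping.keys b0. weight A m = 0" by (rule var_ideal_split[OF b, of A]) blast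
  have "a1 * b \<in> var_ideal n A" "a0 * b1 \<in> var_ideal n A"
    using ideal.I_r_closed[OF var_ideal_is_ideal a'(2) b]
      ideal.I_l_closed[OF var_ideal_is_ideal b'(2) a'(3)] by (simp_all only: poly_ring_simps)
  then have "Poly_Mapping.keys (a * b) \<subseteq> {m. 1 \<le> weight A m}"
    "Poly_Mapping.keys (a1 * b) \<subseteq> {m. 1 \<le> weight A m}"
    "Poly_Mapping.keys (a0 * b1) \<subseteq> {m. 1 \<le> weight A m}"
    using ab by (simp_all only: var_ideal_def monomial_ideal_def mem_Collect_eq poly_ring_simps)
  then have "Poly_Mapping.keys (a * b - a1 * b - a0 * b1) \<subseteq> {m. 1 \<le> weight A m}"
    using keys_diff[of "a * b - a1 * b" "a0 * b1"] keys_diff[of "a * b" "a1 * b"] by blast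
  also have "a * b - a1 * b - a0 * b1 = a0 * b0"
    unfolding a'(1) b'(1) by (simp add: algebra_simps)
  finally have large: "1 \<le> weight A m" if "m \<in> Poly_Mapping.keys (a0 * b0)" for m
    using that by blast
  have small: "weight A m = 0" if m: "m \<in> Poly_Mapping.keys (a0 * b0)" for m
  proof -
    obtain x y where "m = x + y" "x \<in> Poly_Mapping.keys a0" "y \<in> Poly_Mapping.keys b0"
      using m keys_mult[of a0 b0] by blast
    then show ?thesis using a'(4) b'(4) by (simp add: weight_add)
  qed
  have "Poly_Mapping.keys (a0 * b0) = {}"
  proof (rule equals0I)
    show False if "m \<in> Poly_Mapping.keys (a0 * b0)" for m
      using large[OF that] small[OF that] by linarith
  qed
  then have "a0 * b0 = 0" by (simp only: keys_eq_empty)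
  then have "a0 = 0 \<or> b0 = 0" by (simp only: mult_eq_0_iff)
  then show "a \<in> var_ideal n A \<or> b \<in> var_ideal n A" using a'(1,2) b'(1,2) by auto
qed

text \<open>
  A monomial of weight at least \<open>q + 1\<close> has a variable from \<open>A\<close> as a factor, and the cofactor has
  weight at least \<open>q\<close>.
\<close>

lemma ideal_power_var_ideal:
  assumes "finite A"
  shows "ideal_power (poly_ring n) (var_ideal n A :: ('k::field_char_0) mpoly set) q
           = monomial_ideal n {m. q \<le> weight A m}"
proof (induction q)
  case 0
  then show ?case by (auto simp: monomial_ideal_def)
next
  case (Suc q)
  interpret cring "poly_ring n :: 'k mpoly ring" by (rule cring_poly_ring)
  let ?I = "\<lambda>q. monomial_ideal n {m. q \<le> weight A m} :: 'k mpoly set"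
  have I: "ideal (?I q) (poly_ring n)" for q
    by (rule monomial_ideal_is_ideal[OF multiple_closed_weight_single])
  let ?P = "ideal_prod (poly_ring n) (?I q) (var_ideal n A)"
  have "?P = ?I (Suc q)"
  proof
    show "?P \<subseteq> ?I (Suc q)"
    proof
      fix p assume "p \<in> ?P"
      then show "p \<in> ?I (Suc q)"
      proof (induction rule: ideal_prod.induct)
        case (prod a b)
        then have "a * b \<in> carrier (poly_ring n)"
          using m_closed[of a b] by (simp add: var_ideal_def monomial_ideal_def)
        moreover have "Suc q \<le> weight A m" if m: "m \<in> Poly_Mapping.keys (a * b)" for m
        proof -
          obtain x y where "m = x + y" "x \<in> Poly_Mapping.keys a" "y \<in> Poly_Mapping.keys b"
            using m keys_mult[of a b] by blast
          moreover from this have "q \<le> weight A x" "1 \<le> weight A y"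
            using prod by (auto simp: var_ideal_def monomial_ideal_def)
          ultimately show ?thesis by (simp add: weight_add)
        qed
        ultimately show ?case by (auto simp: monomial_ideal_def)
      next
        case (sum a b)
        then show ?case
          using additive_subgroup.a_closed[OF ideal.axioms(1)[OF I]] by blast
      qed
    qed
    show "?I (Suc q) \<subseteq> ?P"
    proof
      fix p assume p: "p \<in> ?I (Suc q)"
      show "p \<in> ?P"
      proof (rule ideal_contains_if_monomials[OF ideal_prod_is_ideal[OF I var_ideal_is_ideal]])
        show "p \<in> carrier (poly_ring n)" using p by (simp add: monomial_ideal_def)
        fix m assume "m \<in> Poly_Mapping.keys p"
        then have m: "Suc q \<le> weight A m" "m \<in> monoms n"
          using p by (auto simp: monomial_ideal_def carrier_poly_ring)
        then have "weight A m \<noteq> 0" by linarith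
        then obtain v where v: "v \<in> A" "Poly_Mapping.lookup m v \<noteq> 0"
          unfolding weight_def by (rule sum.not_neutral_contains_not_neutral)
        let ?r = "m - indet v"
        have meq: "m = ?r + indet v"
          using v by (intro poly_mapping_eqI) (auto simp: lookup_add lookup_minus lookup_single when_def)
        have w: "weight A (indet v) = 1" using weight_var[OF assms, of v] v(1) by simp
        have "weight A m = weight A ?r + weight A (indet v)"
          by (subst (1) meq) (rule weight_add)
        then have "q \<le> weight A ?r" using w m(1) by simp
        moreover have "?r \<in> monoms n" "indet v \<in> monoms n"
          using m(2) monoms_add[of ?r "indet v" n] meq by simp_all
        ultimately have "monom_poly ?r \<otimes>\<^bsub>poly_ring n\<^esub> monom_poly (indet v) \<in> ?P"
          using w by (intro ideal_prod.prod) (auto simp: var_ideal_def monom_poly_in_monomial_ideal)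
        then show "monom_poly m \<in> ?P" using meq by (simp add: mult_single)
      qed
    qed
  qed
  then show ?case using Suc by simp
qed

text \<open>
  The minimal primes belong to the inclusion-minimal members of \<open>\<A>\<close>; the constraints of the other
  members follow from these, since the weight is monotone in \<open>A\<close>.
\<close>

lemma symbolic_power_cover_ideal:
  assumes fin: "finite \<A>" and sub: "\<And>A. A \<in> \<A> \<Longrightarrow> A \<subseteq> {1..n}"
  shows "symbolic_power (poly_ring n)
           (monomial_ideal n {m. \<forall>A\<in>\<A>. 1 \<le> weight A m} :: ('k::field_char_0) mpoly set) q
         = monomial_ideal n {m. \<forall>A\<in>\<A>. q \<le> weight A m}"
proof -
  interpret cring "poly_ring n :: 'k mpoly ring" by (rule cring_poly_ring)
  define \<B> where "\<B> = {A\<in>\<A>. \<forall>B\<in>\<A>. B \<subseteq> A \<longrightarrow> B = A}"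
  have finA: "finite A" if "A \<in> \<A>" for A using sub[OF that] finite_subset by blast
  have min: "\<exists>B\<in>\<B>. B \<subseteq> A" if "A \<in> \<A>" for A
    using finite_has_minimal2[OF fin that] unfolding \<B>_def by (auto 4 3)
  have red: "(\<forall>A\<in>\<B>. q \<le> weight A m) \<longleftrightarrow> (\<forall>A\<in>\<A>. q \<le> weight A m)" for q m
  proof
    assume *: "\<forall>A\<in>\<B>. q \<le> weight A m"
    show "\<forall>A\<in>\<A>. q \<le> weight A m"
    proof
      fix A assume A: "A \<in> \<A>"
      then obtain B where B: "B \<in> \<B>" "B \<subseteq> A" using min by blast
      then have "weight B m \<le> weight A m"
        unfolding weight_def using finA[OF A] by (intro sum_mono2) auto
      then show "q \<le> weight A m" using * B by (meson order_trans)
    qed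
  qed (simp add: \<B>_def)
  let ?Ps = "var_ideal n ` \<B> :: 'k mpoly set set"
  have int: "carrier (poly_ring n) \<inter> \<Inter>?Ps = (monomial_ideal n {m. \<forall>A\<in>\<A>. 1 \<le> weight A m} :: 'k mpoly set)"
    unfolding red[symmetric] by (auto simp: var_ideal_def monomial_ideal_def)
  have "(var_ideal n A :: 'k mpoly set) = var_ideal n B"
    if A: "A \<in> \<B>" and B: "B \<in> \<B>"
      and le: "(var_ideal n A :: 'k mpoly set) \<subseteq> var_ideal n B" for A B
  proof -
    have "A \<subseteq> B"
    proof
      fix v assume v: "v \<in> A"
      have "A \<in> \<A>" "B \<in> \<A>" using A B by (simp_all add: \<B>_def)
      then have "(monom_poly (indet v) :: 'k mpoly) \<in> var_ideal n A"
        using v sub[of A] weight_var[OF finA, of A v]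
        by (simp add: var_ideal_def monom_poly_in_monomial_ideal monoms_def subset_iff)
      then have "(monom_poly (indet v) :: 'k mpoly) \<in> var_ideal n B" using le by blast
      then show "v \<in> B"
        using weight_var[OF finA[OF \<open>B \<in> \<A>\<close>], of v]
        by (simp add: var_ideal_def monom_poly_in_monomial_ideal split: if_splits)
    qed
    then show "(var_ideal n A :: 'k mpoly set) = var_ideal n B" using A B by (auto simp: \<B>_def)
  qed
  then have anti: "\<forall>P\<in>?Ps. \<forall>P'\<in>?Ps. P \<subseteq> P' \<longrightarrow> P = P'" by blast
  have finPs: "finite ?Ps" and primes: "\<forall>P\<in>?Ps. primeideal P (poly_ring n)"
    using fin var_ideal_prime by (auto simp: \<B>_def)
  have the_dec: "(THE Ps. minimal_primary_decomposition (poly_ring n)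
      (monomial_ideal n {m. \<forall>A\<in>\<A>. 1 \<le> weight A m}) Ps) = ?Ps"
    unfolding int[symmetric]
    by (rule the_equality)
      (rule minimal_primary_decomposition_primes[OF finPs primes anti],
       rule minimal_primary_decomposition_unique[OF finPs primes anti])
  have power: "ideal_power (poly_ring n) (var_ideal n A) q
      = (monomial_ideal n {m. q \<le> weight A m} :: 'k mpoly set)" if "A \<in> \<B>" for A
    using that finA by (intro ideal_power_var_ideal) (simp add: \<B>_def)
  have "symbolic_power (poly_ring n)
      (monomial_ideal n {m. \<forall>A\<in>\<A>. 1 \<le> weight A m} :: 'k mpoly set) q
    = carrier (poly_ring n) \<inter> (\<Inter>A\<in>\<B>. monomial_ideal n {m. q \<le> weight A m})"
    unfolding symbolic_power_def the_dec using power by simp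
  also have "\<dots> = monomial_ideal n {m. \<forall>A\<in>\<A>. q \<le> weight A m}"
    unfolding red[symmetric] by (auto simp: monomial_ideal_def)
  finally show ?thesis .
qed

section \<open>Borel moves and covers\<close>

lemma borel_move_add:
  assumes "borel_move x y"
  shows "borel_move (z + x) (z + y)"
proof -
  obtain i j where ij: "i \<in> Poly_Mapping.keys x" "1 \<le> j" "j < i"
    and y: "y = Poly_Mapping.single j 1 + (x - Poly_Mapping.single i 1)"
    using assms unfolding borel_move_def by blast
  have "z + y = Poly_Mapping.single j 1 + ((z + x) - Poly_Mapping.single i 1)"
    unfolding y using ij(1)
    by (intro poly_mapping_eqI) (auto simp: lookup_add lookup_minus lookup_single when_def in_keys_iff)
  moreover have "i \<in> Poly_Mapping.keys (z + x)"
    using ij(1) by (simp add: in_keys_iff lookup_add)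
  ultimately show ?thesis using ij(2,3) unfolding borel_move_def by blast
qed

lemma borel_moves_add: "borel_move\<^sup>*\<^sup>* x y \<Longrightarrow> borel_move\<^sup>*\<^sup>* (z + x) (z + y)"
  by (induction rule: rtranclp_induct) (auto intro: rtranclp.rtrancl_into_rtrancl borel_move_add)

text \<open>
  The variables can be moved down one at a time. Intermediate monomials may fail to be square-free,
  which Borel moves allow.
\<close>

lemma borel_moves_sum:
  assumes "finite L" and "\<forall>l\<in>L. 1 \<le> f l \<and> f l \<le> g l"
  shows "borel_move\<^sup>*\<^sup>* (\<Sum>l\<in>L. Poly_Mapping.single (g l) 1) (\<Sum>l\<in>L. Poly_Mapping.single (f l) 1)"
  using assms
proof (induction L rule: finite_induct)
  case (insert a L)
  let ?F = "\<Sum>l\<in>L. Poly_Mapping.single (f l) 1 :: monom" and ?G = "\<Sum>l\<in>L. Poly_Mapping.single (g l) 1 :: monom"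
  have "borel_move\<^sup>*\<^sup>* (Poly_Mapping.single (g a) 1) (Poly_Mapping.single (f a) 1)"
  proof (cases "f a = g a")
    case False
    then have "f a < g a" "1 \<le> f a" using insert.prems by (auto simp: le_neq_implies_less)
    then have "borel_move (Poly_Mapping.single (g a) 1) (Poly_Mapping.single (f a) 1)"
      unfolding borel_move_def by (intro exI[of _ "g a"] exI[of _ "f a"]) simp
    then show ?thesis by blast
  qed simp
  then have "borel_move\<^sup>*\<^sup>* (Poly_Mapping.single (g a) 1 + ?F) (Poly_Mapping.single (f a) 1 + ?F)"
    unfolding add.commute[of _ ?F] by (rule borel_moves_add)
  with rtranclp_trans[of borel_move] have *: "borel_move\<^sup>*\<^sup>* x (Poly_Mapping.single (g a) 1 + ?F) \<Longrightarrow>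
      borel_move\<^sup>*\<^sup>* x (Poly_Mapping.single (f a) 1 + ?F)" for x
    by blast
  have "borel_move\<^sup>*\<^sup>* (Poly_Mapping.single (g a) 1 + ?G) (Poly_Mapping.single (g a) 1 + ?F)"
    using insert by (intro borel_moves_add) blast
  then have "borel_move\<^sup>*\<^sup>* (Poly_Mapping.single (g a) 1 + ?G) (Poly_Mapping.single (f a) 1 + ?F)"
    by (rule *)
  then show ?case using insert.hyps by simp
qed simp

text \<open>
  Moving a variable to a smaller index never takes weight out of an initial segment. With
  \<open>borel_moves_sum\<close> this makes dominance of prefix weights characterise reachability.
\<close>

lemma borel_move_prefix_weight:
  assumes "borel_move u u'"
  shows "weight {1..N} u \<le> weight {1..N} u'"
proof -
  obtain i j where ij: "i \<in> Poly_Mapping.keys u" "1 \<le> j" "j < i"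
    and u': "u' = Poly_Mapping.single j 1 + (u - Poly_Mapping.single i 1)"
    using assms unfolding borel_move_def by blast
  have "u' + Poly_Mapping.single i 1 = Poly_Mapping.single j 1 + u"
    unfolding u' using ij(1)
    by (intro poly_mapping_eqI) (auto simp: lookup_add lookup_minus lookup_single when_def in_keys_iff)
  then have "weight {1..N} u' + weight {1..N} (Poly_Mapping.single i 1)
      = weight {1..N} (Poly_Mapping.single j 1) + weight {1..N} u"
    by (metis weight_add)
  then show ?thesis
    using ij weight_var[of "{1..N}" i] weight_var[of "{1..N}" j] by (simp split: if_splits)
qed

lemma borel_move_monoms:
  assumes "borel_move u u'" and "u \<in> monoms n"
  shows "u' \<in> monoms n"
proof -
  obtain i j where ij: "i \<in> Poly_Mapping.keys u" "1 \<le> j" "j < i"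
    and u': "u' = Poly_Mapping.single j 1 + (u - Poly_Mapping.single i 1)"
    using assms unfolding borel_move_def by blast
  have "j \<le> n" using ij assms(2) by (force simp: monoms_def)
  moreover have "Poly_Mapping.keys (u - Poly_Mapping.single i 1) \<subseteq> Poly_Mapping.keys u"
    by (auto simp: in_keys_iff lookup_minus)
  ultimately show ?thesis
    unfolding u' monoms_add using ij(2) assms(2) by (auto simp: monoms_def)
qed

lemma borel_moves_invariants:
  assumes "borel_move\<^sup>*\<^sup>* u u'"
  shows "weight {1..N} u \<le> weight {1..N} u'" and "u \<in> monoms n \<Longrightarrow> u' \<in> monoms n"
  using assms
  by (induction rule: rtranclp_induct)
    (auto intro: order_trans borel_move_prefix_weight borel_move_monoms simp del: One_nat_def)

lemma lookup_sum_vars: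
  assumes "finite L" and "inj_on f L"
  shows "Poly_Mapping.lookup (\<Sum>l\<in>L. Poly_Mapping.single (f l) 1 :: monom) v = (if v \<in> f ` L then 1 else 0)"
proof -
  have "(\<Sum>l\<in>L. Poly_Mapping.single (f l) 1 :: monom) = (\<Sum>x\<in>f ` L. Poly_Mapping.single x 1)"
    using assms by (simp add: sum.reindex)
  then show ?thesis using assms(1) by (simp add: lookup_sum lookup_single when_def)
qed

text \<open>
  The sets of \<open>i\<^sub>l - l + 1\<close> indices in \<open>{1..i\<^sub>l}\<close>, written without subtraction. They are vertex covers
  of the hypergraph of generators of the Borel ideal, and the minimal covers are among them.
\<close>

definition covers :: "(nat \<Rightarrow> nat) \<Rightarrow> nat \<Rightarrow> nat set set" where
  "covers i s = {A. \<exists>l\<in>{1..s}. A \<subseteq> {1..i l} \<and> card A + l = i l + 1}"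

lemma strict_mono_nat_gap:
  fixes i :: "nat \<Rightarrow> nat"
  assumes "strict_mono_on {1..s} i" and "1 \<le> j" "j \<le> l" "l \<le> s"
  shows "i j + (l - j) \<le> i l"
  using assms(3,4)
proof (induction l rule: dec_induct)
  case (step k)
  have "i k < i (Suc k)" using assms(1,2) step by (intro strict_mono_onD[OF assms(1)]) auto
  then show ?case using step by simp
qed simp

lemma weight_ge_1_iff: "finite A \<Longrightarrow> 1 \<le> weight A w \<longleftrightarrow> A \<inter> Poly_Mapping.keys w \<noteq> {}"
proof -
  assume "finite A"
  then have "weight A w = 0 \<longleftrightarrow> (\<forall>v\<in>A. Poly_Mapping.lookup w v = 0)" by (simp add: weight_def)
  moreover have "1 \<le> weight A w \<longleftrightarrow> weight A w \<noteq> 0" by linarith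
  ultimately show ?thesis by (auto simp: in_keys_iff simp del: One_nat_def)
qed

text \<open>
  Fewer than \<open>l\<close> indices in \<open>{1..i l}\<close> leave a complement there that contains a cover; conversely, a cover
  for \<open>l\<close> leaves room for only \<open>l - 1\<close> indices of this interval.
\<close>

lemma covers_iff_prefix_counts:
  assumes le: "\<And>l. l \<in> {1..s} \<Longrightarrow> l \<le> i l"
  shows "(\<forall>A\<in>covers i s. 1 \<le> weight A w)
    \<longleftrightarrow> (\<forall>l\<in>{1..s}. l \<le> card (Poly_Mapping.keys w \<inter> {1..i l}))" (is "?L \<longleftrightarrow> ?R")
proof
  assume L: ?L
  show ?R
  proof (rule ballI, rule ccontr)
    fix l assume l: "l \<in> {1..s}" and neg: "\<not> l \<le> card (Poly_Mapping.keys w \<inter> {1..i l})"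
    have "card ({1..i l} - Poly_Mapping.keys w) = i l - card (Poly_Mapping.keys w \<inter> {1..i l})"
      by (subst card_Diff_subset_Int) (auto simp: Int_commute)
    then have "i l + 1 - l \<le> card ({1..i l} - Poly_Mapping.keys w)" using neg by linarith
    then obtain A where A: "A \<subseteq> {1..i l} - Poly_Mapping.keys w" "card A = i l + 1 - l"
      by (meson obtain_subset_with_card_n)
    then have "A \<in> covers i s" using l le[OF l] by (auto simp: covers_def intro!: bexI[of _ l])
    moreover have "finite A" using A(1) finite_subset by blast
    ultimately show False using L A(1) weight_ge_1_iff by blast
  qed
next
  assume R: ?R
  show ?L
  proof (rule ballI, rule ccontr)
    fix A assume "A \<in> covers i s" and neg: "\<not> 1 \<le> weight A w"
    then obtain l where l: "l \<in> {1..s}" "A \<subseteq> {1..i l}" "card A + l = i l + 1"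
      by (auto simp: covers_def)
    have fin: "finite A" using l(2) finite_subset by blast
    then have "Poly_Mapping.keys w \<inter> {1..i l} \<subseteq> {1..i l} - A"
      using neg by (auto simp: weight_ge_1_iff simp del: One_nat_def)
    then have "card (Poly_Mapping.keys w \<inter> {1..i l}) \<le> i l - card A"
      using card_mono[of "{1..i l} - A"] card_Diff_subset[OF fin l(2)] by simp
    then show False using R l(1,3) le[OF l(1)] by fastforce
  qed
qed

text \<open>
  Prefix counts of the support do not decrease from \<open>m\<close> to the generator \<open>u\<close> and to its multiple \<open>w\<close>.
  Conversely, if they are large enough for \<open>w\<close>, then the \<open>s\<close> smallest variables of \<open>w\<close> are termwise
  at most those of \<open>m\<close>, so their product is a generator dividing \<open>w\<close>.
\<close>

lemma sfBorel_eq_cover_ideal: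
  assumes mono: "strict_mono_on {1..s} i" and range: "i ` {1..s} \<subseteq> {1..n}"
    and m: "m = (\<Sum>j=1..s. Poly_Mapping.single (i j) 1)"
  shows "(sfBorel n m :: ('k::field_char_0) mpoly set)
    = monomial_ideal n {w. \<forall>A\<in>covers i s. 1 \<le> weight A w}"
proof -
  have inj: "inj_on i {1..s}" using mono by (rule strict_mono_on_imp_inj_on)
  have lookup_m: "Poly_Mapping.lookup m v = (if v \<in> i ` {1..s} then 1 else 0)" for v
    unfolding m using inj by (rule lookup_sum_vars[OF finite_atLeastAtMost])
  have le: "l \<le> i l" if "l \<in> {1..s}" for l
  proof -
    have "i 1 \<in> i ` {1..s}" using that by (intro imageI) simp
    then have "1 \<le> i 1" using range by (meson atLeastAtMost_iff subsetD)
    then show ?thesis using strict_mono_nat_gap[OF mono, of 1 l] that by simp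
  qed
  have mn: "m \<in> monoms n" using range by (auto simp: monoms_def in_keys_iff lookup_m split: if_splits)
  let ?B = "{u. borel_move\<^sup>*\<^sup>* m u \<and> sqfree_monom u}"
  have "(sfBorel n m :: 'k mpoly set) = monomial_ideal n {w. \<exists>u\<in>?B. \<exists>r. w = u + r}"
    unfolding sfBorel_def
    using genideal_monomials[of ?B n] borel_moves_invariants(2)[of m _ n] mn by auto
  also have "\<dots> = monomial_ideal n {w. \<forall>l\<in>{1..s}. l \<le> card (Poly_Mapping.keys w \<inter> {1..i l})}"
  proof -
    have "(\<exists>u\<in>?B. \<exists>r. w = u + r) \<longleftrightarrow> (\<forall>l\<in>{1..s}. l \<le> card (Poly_Mapping.keys w \<inter> {1..i l}))"
      if wn: "w \<in> monoms n" for w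
    proof
      assume "\<exists>u\<in>?B. \<exists>r. w = u + r"
      then obtain u r where u: "borel_move\<^sup>*\<^sup>* m u" "sqfree_monom u" and w: "w = u + r" by blast
      show "\<forall>l\<in>{1..s}. l \<le> card (Poly_Mapping.keys w \<inter> {1..i l})"
      proof
        fix l assume l: "l \<in> {1..s}"
        have "l = card (i ` {1..l})"
          using card_image[OF inj_on_subset[OF inj, of "{1..l}"]] l by simp
        also have "\<dots> = (\<Sum>v\<in>i ` {1..l}. Poly_Mapping.lookup m v)"
        proof -
          have "i ` {1..l} \<subseteq> i ` {1..s}" using l by (intro image_mono) simp
          then have "Poly_Mapping.lookup m v = 1" if "v \<in> i ` {1..l}" for v
            using that lookup_m by (metis subsetD)
          then show ?thesis by simp
        qed
        also have "\<dots> \<le> weight {1..i l} m"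
          unfolding weight_def
        proof (rule sum_mono2)
          show "i ` {1..l} \<subseteq> {1..i l}"
          proof clarsimp
            fix j assume "Suc 0 \<le> j" "j \<le> l"
            then show "Suc 0 \<le> i j \<and> i j \<le> i l"
              using le[of j] strict_mono_nat_gap[OF mono, of j l] l by simp
          qed
        qed auto
        also have "\<dots> \<le> weight {1..i l} u" using u(1) by (rule borel_moves_invariants)
        also have "\<dots> = (\<Sum>v\<in>Poly_Mapping.keys u \<inter> {1..i l}. Poly_Mapping.lookup u v)"
          unfolding weight_def by (rule sum.mono_neutral_right) (auto simp: in_keys_iff)
        also have "\<dots> \<le> (\<Sum>v\<in>Poly_Mapping.keys u \<inter> {1..i l}. 1)"
          using u(2) by (intro sum_mono) (simp add: sqfree_monom_def)
        also have "\<dots> = card (Poly_Mapping.keys u \<inter> {1..i l})" by simp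
        also have "\<dots> \<le> card (Poly_Mapping.keys w \<inter> {1..i l})"
          unfolding w by (intro card_mono) (auto simp: in_keys_iff lookup_add)
        finally show "l \<le> card (Poly_Mapping.keys w \<inter> {1..i l})" .
      qed
    next
      assume counts: "\<forall>l\<in>{1..s}. l \<le> card (Poly_Mapping.keys w \<inter> {1..i l})"
      define xs where "xs = sorted_list_of_set (Poly_Mapping.keys w)"
      have xs: "set xs = Poly_Mapping.keys w" "sorted xs" "distinct xs"
        "length xs = card (Poly_Mapping.keys w)"
        by (simp_all add: xs_def)
      define f where "f l = xs ! (l - 1)" for l
      have len: "l \<le> length xs" if "l \<in> {1..s}" for l
        using counts that card_mono[of "Poly_Mapping.keys w" "Poly_Mapping.keys w \<inter> {1..i l}"] xs(4)
        by force
      have f_key: "f l \<in> Poly_Mapping.keys w" if "l \<in> {1..s}" for l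
      proof -
        have "1 \<le> l" using that by simp
        then have "l - 1 < length xs" using len[OF that] by linarith
        then show ?thesis unfolding f_def xs(1)[symmetric] by (rule nth_mem)
      qed
      have f_le: "f l \<le> i l" if l: "l \<in> {1..s}" for l
      proof (rule ccontr)
        assume neg: "\<not> f l \<le> i l"
        have "Poly_Mapping.keys w \<inter> {1..i l} \<subseteq> (!) xs ` {..<l - 1}"
        proof
          fix v assume v: "v \<in> Poly_Mapping.keys w \<inter> {1..i l}"
          then have "v \<in> set xs" unfolding xs(1) by simp
          then obtain k where k: "k < length xs" "v = xs ! k" by (auto simp: in_set_conv_nth)
          have "k < l - 1"
          proof (rule ccontr)
            assume "\<not> k < l - 1"
            then have "f l \<le> v" using sorted_nth_mono[OF xs(2), of "l - 1" k] k by (simp add: f_def)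
            then show False using v neg by simp
          qed
          then show "v \<in> (!) xs ` {..<l - 1}" using k by blast
        qed
        then have "card (Poly_Mapping.keys w \<inter> {1..i l}) \<le> card ((!) xs ` {..<l - 1})"
          by (intro card_mono) auto
        also have "\<dots> \<le> l - 1" using card_image_le[of "{..<l - 1}" "(!) xs"] by simp
        finally show False using counts l by fastforce
      qed
      have f_inj: "inj_on f {1..s}"
      proof (rule inj_onI)
        fix k l assume kl: "k \<in> {1..s}" "l \<in> {1..s}" and "f k = f l"
        moreover have "1 \<le> k" "1 \<le> l" using kl by simp_all
        moreover have "k - 1 < length xs" "l - 1 < length xs"
          using len[OF kl(1)] len[OF kl(2)] \<open>1 \<le> k\<close> \<open>1 \<le> l\<close> by linarith+
        ultimately have "k - 1 = l - 1"
          using nth_eq_iff_index_eq[OF xs(3), of "k - 1" "l - 1"] unfolding f_def by blast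
        then show "k = l" using \<open>1 \<le> k\<close> \<open>1 \<le> l\<close> by linarith
      qed
      define u :: monom where "u = (\<Sum>l=1..s. Poly_Mapping.single (f l) 1)"
      have lookup_u: "Poly_Mapping.lookup u v = (if v \<in> f ` {1..s} then 1 else 0)" for v
        unfolding u_def using f_inj by (rule lookup_sum_vars[OF finite_atLeastAtMost])
      have "1 \<le> f l" if "l \<in> {1..s}" for l
        using f_key[OF that] wn by (auto simp: monoms_def)
      then have "borel_move\<^sup>*\<^sup>* m u"
        unfolding m u_def using f_le by (intro borel_moves_sum) auto
      moreover have "sqfree_monom u" by (simp add: sqfree_monom_def lookup_u)
      moreover have "w = u + (w - u)"
      proof (rule poly_mapping_eqI)
        fix v
        have "Poly_Mapping.lookup u v \<le> Poly_Mapping.lookup w v"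
          using f_key by (auto simp: lookup_u in_keys_iff Suc_le_eq)
        then show "Poly_Mapping.lookup w v = Poly_Mapping.lookup (u + (w - u)) v"
          by (simp add: lookup_add lookup_minus)
      qed
      ultimately show "\<exists>u\<in>?B. \<exists>r. w = u + r" by blast
    qed
    then show ?thesis unfolding monomial_ideal_def carrier_poly_ring by blast
  qed
  finally show ?thesis by (simp only: covers_iff_prefix_counts[OF le])
qed

section \<open>The end of the first run of consecutive indices\<close>

text \<open>
  The recursion stops only when no gap is left below the current index.
\<close>

lemma last_T_from:
  assumes "1 \<le> t"
  shows "1 \<le> last (T_from i t) \<and> last (T_from i t) \<le> t \<and> gaps_below i (last (T_from i t)) = {}"
  using assms
proof (induction t rule: less_induct)
  case (less t)
  show ?case
  proof (cases "gaps_below i t = {}")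
    case True
    then show ?thesis using less.prems by (simp add: T_from.simps[of i t])
  next
    case False
    have fin: "finite (gaps_below i t)" by (rule finite_subset[of _ "{..<t}"]) (auto simp: gaps_below_def)
    let ?t = "Max (gaps_below i t)"
    have "1 \<le> ?t" "?t < t" using Max_in[OF fin False] by (auto simp: gaps_below_def)
    moreover have "T_from i ?t \<noteq> []" by (subst T_from.simps) simp
    ultimately show ?thesis using less.IH[of ?t] False by (simp add: T_from.simps[of i t])
  qed
qed

lemma var_index_sum:
  assumes mono: "strict_mono_on {1..s} i" and m: "m = (\<Sum>j=1..s. Poly_Mapping.single (i j) 1)"
  shows "card (Poly_Mapping.keys m) = s" and "j \<in> {1..s} \<Longrightarrow> var_index m j = i j"
proof -
  have inj: "inj_on i {1..s}" using mono by (rule strict_mono_on_imp_inj_on)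
  have keys: "Poly_Mapping.keys m = i ` {1..s}"
    unfolding m by (rule Set.set_eqI) (simp add: in_keys_iff lookup_sum_vars[OF finite_atLeastAtMost inj] del: One_nat_def)
  then show "card (Poly_Mapping.keys m) = s" using inj by (simp add: card_image)
  have set: "set (map i [1..<Suc s]) = Poly_Mapping.keys m" using keys by auto
  have "sorted (map i [1..<Suc s])"
    unfolding sorted_iff_nth_mono
  proof (intro allI impI)
    fix j k assume "j \<le> k" "k < length (map i [1..<Suc s])"
    then show "map i [1..<Suc s] ! j \<le> map i [1..<Suc s] ! k"
      using strict_mono_nat_gap[OF mono, of "Suc j" "Suc k"] by (simp add: nth_append del: upt_Suc)
  qed
  moreover have "distinct (map i [1..<Suc s])"
    using inj by (simp add: distinct_map atLeastLessThanSuc_atLeastAtMost del: upt_Suc)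
  ultimately have "sorted_list_of_set (Poly_Mapping.keys m) = map i [1..<Suc s]"
    unfolding set[symmetric] by (rule sorted_list_of_set.idem_if_sorted_distinct)
  then show "j \<in> {1..s} \<Longrightarrow> var_index m j = i j"
    by (auto simp: var_index_def simp del: upt_Suc)
qed

lemma consecutive_if_no_gaps:
  fixes i :: "nat \<Rightarrow> nat"
  assumes mono: "strict_mono_on {1..s} i" and "1 \<le> t" "t \<le> s" and gaps: "gaps_below i t = {}"
  shows "i t + 1 = i 1 + t"
proof -
  have "i j + 1 = i 1 + j" if "1 \<le> j" "j \<le> t" for j
    using that
  proof (induction j rule: dec_induct)
    case (step k)
    have "k \<notin> gaps_below i t" by (simp add: gaps)
    then have "\<not> i k + 1 < i (k + 1)"
      using step.hyps(1) step.prems unfolding gaps_below_def by simp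
    moreover have "i k < i (k + 1)"
      using step assms(3) by (intro strict_mono_onD[OF mono]) auto
    ultimately show ?case using step by simp
  qed simp
  then show ?thesis using assms(2) by blast
qed

section \<open>The linear optimisation problem\<close>

text \<open>
  The \<open>k\<close> largest values have at least the average of all values. Removing a least element one at
  a time does not lower the average.
\<close>

lemma heavy_subset:
  fixes c :: "'a \<Rightarrow> nat"
  assumes "finite X" and "k \<le> card X"
  shows "\<exists>B\<subseteq>X. card B = k \<and> k * sum c X \<le> card X * sum c B"
  using assms(2)
proof (induction k rule: inc_induct)
  case base
  then show ?case by blast
next
  case (step k)
  then obtain B where B: "B \<subseteq> X" "card B = Suc k" "Suc k * sum c X \<le> card X * sum c B" by blast
  have fin: "finite B" using B(1) assms(1) finite_subset by blast
  have "B \<noteq> {}" using B(2) by auto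
  then obtain b where b: "b \<in> B" "\<forall>x\<in>B. c b \<le> c x"
    using ex_min_if_finite[of "c ` B"] fin by (force simp: not_less)
  have S: "sum c B = c b + sum c (B - {b})" using fin b(1) by (simp add: sum.remove)
  have card: "card (B - {b}) = k" using B(2) b(1) by simp
  have "k * c b \<le> sum c (B - {b})"
    using sum_bounded_below[of "B - {b}" "c b" c] b(2) card by simp
  then have *: "k * sum c B \<le> Suc k * sum c (B - {b})" unfolding S by (simp add: algebra_simps)
  \<comment> \<open>The averages before and after the removal are compared with a common factor \<open>Suc k\<close>.\<close>
  have "Suc k * (k * sum c X) = k * (Suc k * sum c X)" by (rule mult.left_commute)
  also have "\<dots> \<le> k * (card X * sum c B)" using B(3) by (rule mult_le_mono2)
  also have "\<dots> = card X * (k * sum c B)" by (rule mult.left_commute)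
  also have "\<dots> \<le> card X * (Suc k * sum c (B - {b}))" using * by (rule mult_le_mono2)
  also have "\<dots> = Suc k * (card X * sum c (B - {b}))" by (rule mult.left_commute)
  finally have "k * sum c X \<le> card X * sum c (B - {b})" by (simp only: Suc_mult_le_cancel1)
  then show ?case using B(1) card by blast
qed

lemma light_subset:
  fixes c :: "'a \<Rightarrow> nat"
  assumes "finite X" and "k \<le> card X"
  shows "\<exists>B\<subseteq>X. card B = k \<and> card X * sum c B \<le> k * sum c X"
proof -
  \<comment> \<open>The complement of a heavy set is light.\<close>
  obtain B where B: "B \<subseteq> X" "card B = card X - k" "(card X - k) * sum c X \<le> card X * sum c B"
    using heavy_subset[OF assms(1), of "card X - k" c] by auto
  have "sum c X = sum c (X - B) + sum c B" using assms(1) B(1) by (simp add: sum.subset_diff)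
  then have "card X * sum c (X - B) + card X * sum c B = card X * sum c X"
    by (simp add: algebra_simps)
  moreover have "card X * sum c X = k * sum c X + (card X - k) * sum c X"
    using assms(2) by (simp flip: distrib_right)
  ultimately have "card X * sum c (X - B) \<le> k * sum c X" using B(3) by linarith
  moreover have "card (X - B) = k"
    using B assms by (simp add: card_Diff_subset finite_subset)
  ultimately show ?thesis by blast
qed

text \<open>
  If all \<open>p\<close>-element subsets have sum at least \<open>q\<close>, then some \<open>r\<close>-element subset has average at least
  \<open>q / p\<close>. For \<open>r \<le> p\<close> take the largest elements of a \<open>p\<close>-element subset; for \<open>r > p\<close> any
  \<open>r\<close>-element subset works, because its \<open>p\<close> smallest elements already have that average.
\<close>

lemma subset_average:
  fixes c :: "'a \<Rightarrow> nat"
  assumes "finite X" and "p \<le> card X" "r \<le> card X"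
    and large: "\<And>A. A \<subseteq> X \<Longrightarrow> card A = p \<Longrightarrow> q \<le> sum c A"
  shows "\<exists>B\<subseteq>X. card B = r \<and> r * q \<le> p * sum c B"
proof (cases "r \<le> p")
  case True
  obtain Y where Y: "Y \<subseteq> X" "card Y = p" using assms(2) by (meson obtain_subset_with_card_n)
  then obtain B where B: "B \<subseteq> Y" "card B = r" "r * sum c Y \<le> p * sum c B"
    using heavy_subset[of Y r c] True assms(1) finite_subset by metis
  have "r * q \<le> r * sum c Y" using large[OF Y] by simp
  then have "r * q \<le> p * sum c B" using B(3) by (rule order_trans)
  then show ?thesis using B Y(1) by blast
next
  case False
  obtain Y where Y: "Y \<subseteq> X" "card Y = r" using assms(3) by (meson obtain_subset_with_card_n)
  then obtain B where B: "B \<subseteq> Y" "card B = p" "r * sum c B \<le> p * sum c Y"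
    using light_subset[of Y p c] False assms(1) finite_subset by (metis nat_le_linear)
  have "r * q \<le> r * sum c B" using large[of B] B Y(1) by simp
  then have "r * q \<le> p * sum c Y" using B(3) by (rule order_trans)
  then show ?thesis using Y by blast
qed

lemma weight_le_monom_degree:
  assumes "finite A"
  shows "weight A w \<le> monom_degree w"
proof -
  have "weight A w = (\<Sum>v\<in>A \<inter> Poly_Mapping.keys w. Poly_Mapping.lookup w v)"
    unfolding weight_def using assms by (intro sum.mono_neutral_right) (auto simp: in_keys_iff)
  also have "\<dots> \<le> monom_degree w" unfolding monom_degree_def by (rule sum_mono2) auto
  finally show ?thesis .
qed

text \<open>
  The heavy set \<open>B\<close> of \<open>s - 1\<close> indices in \<open>{1..i t}\<close> and its complement in \<open>{1..i s}\<close>, which is a cover,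
  contribute separately.
\<close>

lemma degree_lower_bound:
  fixes i :: "nat \<Rightarrow> nat"
  assumes mono: "strict_mono_on {1..s} i"
    and t: "1 \<le> t" "t \<le> s" "i t + 1 = i 1 + t" and "s \<le> i t"
    and w: "\<forall>A\<in>covers i s. q \<le> weight A w"
  shows "q * (i 1 + s - 1) \<le> i 1 * monom_degree w"
proof -
  have "\<exists>B\<subseteq>{1..i t}. card B = s - 1 \<and> (s - 1) * q \<le> i 1 * sum (Poly_Mapping.lookup w) B"
  proof (rule subset_average)
    fix A assume "A \<subseteq> {1..i t}" "card A = i 1"
    then have "A \<in> covers i s" using t by (auto simp: covers_def intro!: bexI[of _ t])
    then show "q \<le> sum (Poly_Mapping.lookup w) A" using w by (simp add: weight_def)
  qed (use t \<open>s \<le> i t\<close> in auto)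
  then obtain B where B: "B \<subseteq> {1..i t}" "card B = s - 1" "(s - 1) * q \<le> i 1 * weight B w"
    by (auto simp: weight_def)
  have it: "i t \<le> i s" using strict_mono_nat_gap[OF mono t(1,2)] by simp
  then have Bs: "B \<subseteq> {1..i s}" using B(1) by auto
  have "card ({1..i s} - B) + s = i s + 1"
    using B(2) Bs it t \<open>s \<le> i t\<close> by (simp add: card_Diff_subset finite_subset[OF Bs])
  then have "{1..i s} - B \<in> covers i s" using t by (auto simp: covers_def intro!: bexI[of _ s])
  then have A: "q \<le> weight ({1..i s} - B) w" using w by blast
  have "weight ({1..i s} - B) w + weight B w = weight {1..i s} w"
    unfolding weight_def using Bs by (simp add: sum.subset_diff[symmetric])
  then have "i 1 * weight ({1..i s} - B) w + i 1 * weight B w \<le> i 1 * monom_degree w"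
    using weight_le_monom_degree[of "{1..i s}" w] by (simp flip: distrib_left)
  moreover have "i 1 * q \<le> i 1 * weight ({1..i s} - B) w" using A by simp
  moreover have "q * (i 1 + s - 1) = i 1 * q + (s - 1) * q"
    using t by (cases s) (simp_all add: algebra_simps)
  ultimately show ?thesis using B(3) by linarith
qed

text \<open>
  The witness has the constant exponent \<open>e\<close>, the least integer above \<open>q / i 1\<close>, on the first \<open>K\<close>
  variables. A cover \<open>A \<subseteq> {1..i l}\<close> misses only \<open>l - 1\<close> indices of its interval, so at least
  \<open>K - (l - 1) \<ge> i 1\<close> of the first \<open>K\<close> indices lie in it when \<open>K \<le> i l\<close>; otherwise all
  \<open>i l - l + 1 \<ge> i 1\<close> indices of \<open>A\<close> do.
\<close>

lemma degree_upper_bound: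
  fixes i :: "nat \<Rightarrow> nat"
  assumes mono: "strict_mono_on {1..s} i" and pos: "1 \<le> i 1" and "1 \<le> s" and "i s \<le> n"
  shows "\<exists>w\<in>monoms n. (\<forall>A\<in>covers i s. q \<le> weight A w) \<and>
    i 1 * monom_degree w \<le> (i 1 + s - 1) * (q + i 1)"
proof -
  define K where "K = i 1 + s - 1"
  define e where "e = q div i 1 + 1"
  define w :: monom where "w = (\<Sum>v=1..K. Poly_Mapping.single v e)"
  have lookup: "Poly_Mapping.lookup w v = (if v \<in> {1..K} then e else 0)" for v
    unfolding w_def by (simp add: lookup_sum lookup_single when_def)
  have e_pos: "0 < e" by (simp add: e_def)
  have keys: "Poly_Mapping.keys w = {1..K}"
    by (rule Set.set_eqI) (simp add: in_keys_iff lookup e_pos del: One_nat_def)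
  have gap: "i 1 + (l - 1) \<le> i l" if "l \<in> {1..s}" for l
    using strict_mono_nat_gap[OF mono, of 1 l] that by simp
  have "K \<le> n" using gap[of s] assms(3,4) by (simp add: K_def)
  then have "w \<in> monoms n" by (simp add: monoms_def keys)
  moreover have "q \<le> weight A w" if "A \<in> covers i s" for A
  proof -
    obtain l where l: "l \<in> {1..s}" "A \<subseteq> {1..i l}" "card A + l = i l + 1"
      using \<open>A \<in> covers i s\<close> by (auto simp: covers_def)
    have fin: "finite A" using l(2) finite_subset by blast
    have "card A \<le> card ((A \<inter> {1..K}) \<union> {K<..i l})" using l(2) fin by (intro card_mono) auto
    also have "\<dots> \<le> card (A \<inter> {1..K}) + card {K<..i l}" by (rule card_Un_le)
    finally have "i 1 \<le> card (A \<inter> {1..K})"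
      using l gap[OF l(1)] by (cases "K \<le> i l") (auto simp: K_def)
    have "q = i 1 * (q div i 1) + q mod i 1" by simp
    also have "\<dots> \<le> i 1 * (q div i 1) + i 1" using pos mod_less_divisor[of "i 1" q] by linarith
    also have "\<dots> = i 1 * e" by (simp add: e_def)
    also have "\<dots> \<le> card (A \<inter> {1..K}) * e" using \<open>i 1 \<le> _\<close> by (rule mult_le_mono1)
    also have "\<dots> = weight A w"
      unfolding weight_def lookup using fin by (simp add: sum.If_cases flip: atLeastAtMost_iff)
    finally show ?thesis .
  qed
  moreover have "i 1 * monom_degree w \<le> K * (q + i 1)"
  proof -
    have "monom_degree w = K * e" unfolding monom_degree_def keys lookup by simp
    then have "i 1 * monom_degree w = K * (i 1 * (q div i 1) + i 1)" by (simp add: e_def algebra_simps)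
    also have "\<dots> \<le> K * (q + i 1)" by (intro mult_le_mono2 add_le_mono) simp_all
    finally show ?thesis .
  qed
  ultimately show ?thesis unfolding K_def by blast
qed

lemma tendsto_if_linear_bounds:
  fixes a :: "nat \<Rightarrow> nat" and p r :: nat
  assumes "p \<noteq> 0" and lower: "\<And>q. q * r \<le> p * a q" and upper: "\<And>q. p * a q \<le> r * (q + p)"
  shows "(\<lambda>q. real (a q) / real q) \<longlonglongrightarrow> real r / real p"
proof (rule tendsto_sandwich)
  show "\<forall>\<^sub>F q in sequentially. real r / real p \<le> real (a q) / real q"
    using eventually_gt_at_top[of 0]
  proof eventually_elim
    case (elim q)
    have "real (q * r) \<le> real (p * a q)" using lower by (simp only: of_nat_le_iff)
    then show ?case using elim assms(1) by (simp add: field_simps)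
  qed
  show "\<forall>\<^sub>F q in sequentially. real (a q) / real q \<le> real r / real p + real r * (1 / real q)"
    using eventually_gt_at_top[of 0]
  proof eventually_elim
    case (elim q)
    have "real (p * a q) \<le> real (r * (q + p))" using upper by (simp only: of_nat_le_iff)
    then show ?case using elim assms(1) by (simp add: field_simps)
  qed
  have "(\<lambda>q. real r / real p + real r * (1 / real q)) \<longlonglongrightarrow> real r / real p + real r * 0"
    by (intro tendsto_intros lim_1_over_n)
  then show "(\<lambda>q. real r / real p + real r * (1 / real q)) \<longlonglongrightarrow> real r / real p" by simp
qed simp

section \<open>The Waldschmidt constant of a square-free Borel ideal\<close>

theorem theorem4p1:
  fixes n s :: nat and i :: "nat \<Rightarrow> nat" and m :: monom
    and I :: "('k::field_char_0) mpoly set"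
  assumes "1 \<le> s"
    and "strict_mono_on {1..s} i"
    and "i ` {1..s} \<subseteq> {1..n}"
    and "m = (\<Sum>j=1..s. Poly_Mapping.single (i j) 1)"
    and "I = sfBorel n m"
    and "hd (T_tuple m) \<le> last (IT_tuple m)"
  shows "convergent (waldschmidt_seq n I) \<and>
    waldschmidt_constant n I =
      1 + (real s - 1) / (real (last (IT_tuple m)) - real (last (T_tuple m)) + 1)"
proof -
  note mono = assms(2)
  have i_range: "1 \<le> i j \<and> i j \<le> n" if "1 \<le> j" "j \<le> s" for j
  proof -
    have "i j \<in> i ` {1..s}" using that by (intro imageI) simp
    then show ?thesis using assms(3) by (meson atLeastAtMost_iff subsetD)
  qed
  have card: "card (Poly_Mapping.keys m) = s" by (rule var_index_sum(1)[OF mono assms(4)])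
  define t where "t = last (T_tuple m)"
  have t: "1 \<le> t" "t \<le> s" and "gaps_below (var_index m) t = {}"
    using last_T_from[OF assms(1), of "var_index m"] by (simp_all add: t_def T_tuple_def card)
  moreover have "gaps_below (var_index m) t = gaps_below i t"
    using t(2) var_index_sum(2)[OF mono assms(4)] by (auto simp: gaps_below_def)
  ultimately have it: "i t + 1 = i 1 + t"
    by (intro consecutive_if_no_gaps[OF mono]) simp_all
  have T: "T_tuple m \<noteq> []" "hd (T_tuple m) = s"
    unfolding T_tuple_def card by (simp_all add: T_from.simps[of _ s])
  have "last (IT_tuple m) = var_index m t"
    using T(1) by (simp add: IT_tuple_def t_def last_map)
  then have IT: "last (IT_tuple m) = i t"
    using t var_index_sum(2)[OF mono assms(4), of t] by simp
  have "s \<le> i t" using assms(6) T(2) IT by simp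

  have sub: "A \<subseteq> {1..n}" if A: "A \<in> covers i s" for A
  proof -
    obtain l where "1 \<le> l" "l \<le> s" "A \<subseteq> {1..i l}" using A by (auto simp: covers_def)
    then show ?thesis using i_range[of l] by fastforce
  qed
  then have fin: "finite (covers i s)" by (intro finite_subset[of "covers i s" "Pow {1..n}"]) auto
  define \<alpha> where "\<alpha> q = initial_degree n (symbolic_power (poly_ring n) I q)" for q
  have symb: "symbolic_power (poly_ring n) I q = monomial_ideal n {w. \<forall>A\<in>covers i s. q \<le> weight A w}" for q
    unfolding assms(5) sfBorel_eq_cover_ideal[OF mono assms(3,4)]
    by (rule symbolic_power_cover_ideal[OF fin sub])
  have \<alpha>: "\<alpha> q = (LEAST d. \<exists>w\<in>{w. \<forall>A\<in>covers i s. q \<le> weight A w} \<inter> monoms n. monom_degree w = d)" for q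
    unfolding \<alpha>_def symb by (rule initial_degree_monomial_ideal[OF multiple_closed_weight])
  have upper: "\<exists>w\<in>{w. \<forall>A\<in>covers i s. q \<le> weight A w} \<inter> monoms n.
      i 1 * monom_degree w \<le> (i 1 + s - 1) * (q + i 1)" for q
    using degree_upper_bound[OF mono, of n q] i_range[of 1] i_range[of s] assms(1) by blast
  have attained: "\<exists>w\<in>{w. \<forall>A\<in>covers i s. q \<le> weight A w} \<inter> monoms n. monom_degree w = \<alpha> q" for q
    unfolding \<alpha> by (rule LeastI_ex) (use upper in blast)
  have "(\<lambda>q. real (\<alpha> q) / real q) \<longlonglongrightarrow> real (i 1 + s - 1) / real (i 1)"
  proof (rule tendsto_if_linear_bounds)
    show "i 1 \<noteq> 0" using i_range[of 1] assms(1) by simp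
    show "q * (i 1 + s - 1) \<le> i 1 * \<alpha> q" for q
    proof -
      obtain w where "\<forall>A\<in>covers i s. q \<le> weight A w" "monom_degree w = \<alpha> q"
        using attained by blast
      then show ?thesis
        using degree_lower_bound[OF mono t it \<open>s \<le> i t\<close>, of q w] by simp
    qed
    show "i 1 * \<alpha> q \<le> (i 1 + s - 1) * (q + i 1)" for q
    proof -
      obtain w where w: "w \<in> {w. \<forall>A\<in>covers i s. q \<le> weight A w} \<inter> monoms n"
        "i 1 * monom_degree w \<le> (i 1 + s - 1) * (q + i 1)" using upper by blast
      have "\<alpha> q \<le> monom_degree w" unfolding \<alpha> using w(1) by (intro Least_le) blast
      then have "i 1 * \<alpha> q \<le> i 1 * monom_degree w" by (rule mult_le_mono2)
      then show ?thesis using w(2) by (rule order_trans)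
    qed
  qed
  then have lim: "waldschmidt_seq n I \<longlonglongrightarrow> real (i 1 + s - 1) / real (i 1)"
    by (simp add: waldschmidt_seq_def[abs_def] \<alpha>_def)
  have "real (i t) + 1 = real (i 1) + real t" using it by (metis of_nat_1 of_nat_add)
  then have denom: "real (last (IT_tuple m)) - real (last (T_tuple m)) + 1 = real (i 1)"
    by (simp add: IT t_def[symmetric])
  have "real (i 1 + s - 1) / real (i 1) = 1 + (real s - 1) / real (i 1)"
    using i_range[of 1] assms(1) by (simp add: of_nat_diff field_simps)
  then have "waldschmidt_constant n I = 1 + (real s - 1) / real (i 1)"
    unfolding waldschmidt_constant_def using limI[OF lim] by simp
  then show ?thesis using lim unfolding denom by (auto simp: convergent_def)
qed

end
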